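(* Every $1$-step groupspace is isomorphic to $\mathcal{D}_1(G)$ for some group $G$.
   Context: Notation: $[n]=\{1,\dots,n\}$; $\{0,1\}^0$ is a one point set; $1^n$ is the all-one vector; $\{0,1\}^n_*=\{0,1\}^n\setminus\{1^n\}$. $\mathcal{G}$-morphisms: a map $\phi:\{0,1\}^n\to\{0,1\}^m$ is a morphism in $\mathcal{G}$ if for every $i\in[m]$ the function $v\mapsto\phi(v)_i$ is either constant (then put $\gamma_\phi(i)=0$) or equal to $v\mapsto v_j$ or $v\mapsto 1-v_j$ for some $j\in[n]$ (then put $\gamma_\phi(i)=j$), and for all $1\le i<j\le m$ either $\gamma_\phi(j)=0$ or $\gamma_\phi(i)\le\gamma_\phi(j)$. For $i\in[n]$, $j\in\{0,1\}$ the face embedding $e^n_{i,j}:\{0,1\}^{n-1}\to\{0,1\}^n$ is $e^n_{i,j}(x_1,\dots,x_{n-1})=(x_1,\dots,x_{i-1},j,x_i,\dots,x_{n-1})$. A cube-structure is a set $X$ with subsets $C^n(X)\subseteq X^{\{0,1\}^n}$ for $n=0,1,2,\dots$. It is a groupspace if: (presheaf) $\psi\in C^m(X)$ and $\phi:\{0,1\}^n\to\{0,1\}^m$ a morphism in $\mathcal{G}$ imply $\psi\circ\phi\in C^n(X)$; (ergodicity) $C^1(X)=X^{\{0,1\}}$; (completion) for every $n\ge 0$, if $f:\{0,1\}^n_*\to X$ satisfies $f\circ e^n_{i,0}\in C^{n-1}(X)$ for all $i\in[n]$, then some $\phi\in C^n(X)$ restricts to $f$ on $\{0,1\}^n_*$.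 A groupspace is $k$-step if for $n=k+1$ the completion $\phi$ is always uniquely determined by $f$. Two cube-structures are isomorphic if there is a bijection $m$ between them such that, for all $n$, $c$ is an $n$-cube of the first if and only if $m\circ c$ is an $n$-cube of the second. For a group $G$, $\mathcal{D}_1(G)$ is the cube-structure on the set $G$ for which $C^n(G)$ is the set of all maps $\{0,1\}^n\to G$ of the form $v\mapsto a_0a_1^{v_1}a_2^{v_2}\cdots a_n^{v_n}$ with $a_0,a_1,\dots,a_n\in G$. *)

theory Defs
  imports "HOL-Algebra.Group" "HOL-Library.FuncSet"
begin

text \<open>
  A vertex of the discrete \<open>n\<close>-cube is an extensional function on the index set \<open>{1..n}\<close>, and
  all maps out of (subsets of) discrete cubes are extensional as well, so that equality of
  functions is equality of maps.
\<close>

definition cube :: "nat \<Rightarrow> (nat \<Rightarrow> nat) set" where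
  "cube n = {1..n} \<rightarrow>\<^sub>E {0, 1}"

definition all_one :: "nat \<Rightarrow> (nat \<Rightarrow> nat)" where
  "all_one n = (\<lambda>i\<in>{1..n}. 1)"

definition punctured_cube :: "nat \<Rightarrow> (nat \<Rightarrow> nat) set" where
  "punctured_cube n = cube n - {all_one n}"

definition is_const :: "nat \<Rightarrow> ((nat \<Rightarrow> nat) \<Rightarrow> (nat \<Rightarrow> nat)) \<Rightarrow> nat \<Rightarrow> bool" where
  "is_const n \<phi> i \<longleftrightarrow> (\<exists>c. \<forall>v\<in>cube n. \<phi> v i = c)"

definition depends_as :: "nat \<Rightarrow> ((nat \<Rightarrow> nat) \<Rightarrow> (nat \<Rightarrow> nat)) \<Rightarrow> nat \<Rightarrow> nat \<Rightarrow> bool" where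
  "depends_as n \<phi> i j \<longleftrightarrow> j \<in> {1..n} \<and>
     ((\<forall>v\<in>cube n. \<phi> v i = v j) \<or> (\<forall>v\<in>cube n. \<phi> v i = 1 - v j))"

text \<open>The index \<open>j\<close> selected below is unique by lemma \<open>depends_as_unique\<close>.\<close>

definition gam :: "nat \<Rightarrow> ((nat \<Rightarrow> nat) \<Rightarrow> (nat \<Rightarrow> nat)) \<Rightarrow> nat \<Rightarrow> nat" where
  "gam n \<phi> i = (if is_const n \<phi> i then 0 else (THE j. depends_as n \<phi> i j))"

lemma depends_as_unique:
  assumes "depends_as n \<phi> i j" "depends_as n \<phi> i k"
  shows "j = k"
proof (rule ccontr)
  assume "j \<noteq> k"
  let ?u = "\<lambda>l\<in>{1..n}. 0 :: nat" and ?w = "\<lambda>l\<in>{1..n}. if l = j then 1 else 0 :: nat"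
  have "?u \<in> cube n" "?w \<in> cube n"
    by (auto simp: cube_def)
  with assms \<open>j \<noteq> k\<close> show False
    unfolding depends_as_def by fastforce
qed

lemma depends_as_not_const:
  assumes "depends_as n \<phi> i j"
  shows "\<not> is_const n \<phi> i"
proof
  assume "is_const n \<phi> i"
  then obtain c where c: "\<And>v. v \<in> cube n \<Longrightarrow> \<phi> v i = c"
    unfolding is_const_def by blast
  have in_cube: "(\<lambda>l\<in>{1..n}. 0) \<in> cube n" "(\<lambda>l\<in>{1..n}. 1) \<in> cube n"
    by (auto simp: cube_def)
  from assms c[OF in_cube(1)] c[OF in_cube(2)] in_cube show False
    unfolding depends_as_def by fastforce
qed

definition cube_morphism :: "nat \<Rightarrow> nat \<Rightarrow> ((nat \<Rightarrow> nat) \<Rightarrow> (nat \<Rightarrow> nat)) \<Rightarrow> bool" where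
  "cube_morphism n m \<phi> \<longleftrightarrow>
     \<phi> \<in> cube n \<rightarrow>\<^sub>E cube m \<and>
     (\<forall>i\<in>{1..m}. is_const n \<phi> i \<or> (\<exists>j. depends_as n \<phi> i j)) \<and>
     (\<forall>i\<in>{1..m}. \<forall>j\<in>{1..m}. i < j \<longrightarrow> gam n \<phi> j = 0 \<or> gam n \<phi> i \<le> gam n \<phi> j)"

definition face :: "nat \<Rightarrow> nat \<Rightarrow> nat \<Rightarrow> (nat \<Rightarrow> nat) \<Rightarrow> (nat \<Rightarrow> nat)" where
  "face n i j = (\<lambda>x\<in>cube (n - 1). \<lambda>l\<in>{1..n}. if l < i then x l else if l = i then j else x (l - 1))"

locale cube_structure =
  fixes X :: "'a set" and C :: "nat \<Rightarrow> ((nat \<Rightarrow> nat) \<Rightarrow> 'a) set"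
  assumes cubes_subset: "C n \<subseteq> cube n \<rightarrow>\<^sub>E X"
begin

definition corner :: "nat \<Rightarrow> ((nat \<Rightarrow> nat) \<Rightarrow> 'a) \<Rightarrow> bool" where
  "corner n f \<longleftrightarrow> f \<in> punctured_cube n \<rightarrow>\<^sub>E X \<and>
     (\<forall>i\<in>{1..n}. compose (cube (n - 1)) f (face n i 0) \<in> C (n - 1))"

definition completes :: "nat \<Rightarrow> ((nat \<Rightarrow> nat) \<Rightarrow> 'a) \<Rightarrow> ((nat \<Rightarrow> nat) \<Rightarrow> 'a) \<Rightarrow> bool" where
  "completes n f \<phi> \<longleftrightarrow> \<phi> \<in> C n \<and> restrict \<phi> (punctured_cube n) = f"

end

locale groupspace = cube_structure +
  assumes presheaf: "\<psi> \<in> C m \<Longrightarrow> cube_morphism n m \<phi> \<Longrightarrow> compose (cube n) \<psi> \<phi> \<in> C n"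
    and ergodicity: "C 1 = cube 1 \<rightarrow>\<^sub>E X"
    and completion: "corner n f \<Longrightarrow> \<exists>\<phi>. completes n f \<phi>"

locale step_groupspace = groupspace X C
  for k :: nat and X :: "'a set" and C :: "nat \<Rightarrow> ((nat \<Rightarrow> nat) \<Rightarrow> 'a) set" +
  assumes unique_completion: "corner (k + 1) f \<Longrightarrow> \<exists>!\<phi>. completes (k + 1) f \<phi>"

definition cube_structures_isomorphic ::
  "'a set \<Rightarrow> (nat \<Rightarrow> ((nat \<Rightarrow> nat) \<Rightarrow> 'a) set) \<Rightarrow>
   'b set \<Rightarrow> (nat \<Rightarrow> ((nat \<Rightarrow> nat) \<Rightarrow> 'b) set) \<Rightarrow> bool" where
  "cube_structures_isomorphic X C Y D \<longleftrightarrow>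
     (\<exists>m. bij_betw m X Y \<and>
       (\<forall>n. \<forall>c \<in> cube n \<rightarrow>\<^sub>E X. c \<in> C n \<longleftrightarrow> compose (cube n) m c \<in> D n))"

text \<open>
  The cubes of the cube-structure \<open>D\<^sub>1(G)\<close>, whose underlying set is \<open>carrier G\<close>. The group need not
  be commutative; the product is taken in order of increasing index.
\<close>

definition D1_cubes :: "('a, 'b) monoid_scheme \<Rightarrow> nat \<Rightarrow> ((nat \<Rightarrow> nat) \<Rightarrow> 'a) set" where
  "D1_cubes G n =
     {(\<lambda>v\<in>cube n. a 0 \<otimes>\<^bsub>G\<^esub>
        foldr (\<otimes>\<^bsub>G\<^esub>) (map (\<lambda>i. a i [^]\<^bsub>G\<^esub> v i) [1..<Suc n]) \<one>\<^bsub>G\<^esub>) | a. a \<in> {0..n} \<rightarrow> carrier G}"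

lemma (in group) cube_structure_D1: "cube_structure (carrier G) (D1_cubes G)"
proof
  fix n
  have "foldr (\<otimes>) (map (\<lambda>i. a i [^] (v i :: nat)) is) \<one> \<in> carrier G"
    if "\<And>i. i \<in> set is \<Longrightarrow> a i \<in> carrier G" for a v and "is" :: "nat list"
    using that by (induction "is") auto
  then show "D1_cubes G n \<subseteq> cube n \<rightarrow>\<^sub>E carrier G"
    unfolding D1_cubes_def by (fastforce simp: Pi_iff simp del: upt_Suc)
qed

end

theory Submission imports Defs begin

text \<open>
  In \<open>D\<^sub>1(G)\<close> a 2-cube with values \<open>a, b, c, d\<close> at \<open>00, 10, 01, 11\<close> is exactly one with
  \<open>a\<^sup>-\<^sup>1 c = b\<^sup>-\<^sup>1 d\<close>. So in a 1-step groupspace the squares should say that the pairs \<open>(a, c)\<close> and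
  \<open>(b, d)\<close> represent the same right translation. Squares can be glued in both directions because
  the glued square is a diagonal of a 3-cube obtained by completion; with the reflections this
  makes the translations a group acting simply transitively, and after fixing a base point \<open>e\<close> the
  product \<open>x y\<close> is the fourth vertex of the square with \<open>e, x, y\<close> at \<open>00, 10, 01\<close>.
  For larger cubes, restricting an \<open>(n + 1)\<close>-cube to squares spanned by \<open>0\<close>, a vertex \<open>w\<close> of the
  lower face and the last coordinate direction shows that all edges in the last direction are the
  same translation, which gives the form \<open>a\<^sub>0 a\<^sub>1\<^bsup>v1\<^esup> \<dots>\<close>. Conversely, completion yields the maps of
  that form, since they are determined by their values off \<open>1\<^sup>n\<close>.
\<close>

section \<open>Morphisms of discrete cubes from index maps and signs\<close>

definition signed_morphism ::
  "nat \<Rightarrow> nat \<Rightarrow> (nat \<Rightarrow> nat) \<Rightarrow> (nat \<Rightarrow> bool) \<Rightarrow> (nat \<Rightarrow> nat) \<Rightarrow> (nat \<Rightarrow> nat)" where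
  "signed_morphism n m g s = (\<lambda>v\<in>cube n. \<lambda>i\<in>{1..m}.
     let t = (if g i = 0 then 0 else v (g i)) in if s i then 1 - t else t)"

lemma cube_val: "v \<in> cube n \<Longrightarrow> i \<in> {1..n} \<Longrightarrow> v i = 0 \<or> v i = 1"
  unfolding cube_def by fastforce

lemma cube_val_Suc_0: "v \<in> cube n \<Longrightarrow> i \<in> {1..n} \<Longrightarrow> v i = 0 \<or> v i = Suc 0"
  using cube_val by fastforce

lemma restrict_in_cube:
  "(\<And>i. i \<in> {1..n} \<Longrightarrow> f i = 0 \<or> f i = 1) \<Longrightarrow> restrict f {1..n} \<in> cube n"
  unfolding cube_def by fastforce

lemma restrict_cube_id: "v \<in> cube n \<Longrightarrow> restrict v {1..n} = v"
  unfolding cube_def by (simp add: PiE_restrict)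

lemma cube_eqI:
  "v \<in> cube n \<Longrightarrow> w \<in> cube n \<Longrightarrow> (\<And>i. i \<in> {1..n} \<Longrightarrow> v i = w i) \<Longrightarrow> v = w"
  unfolding cube_def by (rule PiE_ext)

text \<open>The index \<open>g i = 0\<close> marks a constant coordinate, with value 1 exactly where
  \<open>s i\<close> holds; any other coordinate depends on \<open>g i\<close>. As this index is
  unique, \<open>gam\<close> returns \<open>g\<close>, and \<open>mono\<close> becomes the order
  condition on morphisms.\<close>

lemma signed_morphism_is_morphism:
  assumes g: "\<And>i. i \<in> {1..m} \<Longrightarrow> g i \<le> n"
    and mono: "\<And>i j. i \<in> {1..m} \<Longrightarrow> j \<in> {1..m} \<Longrightarrow> i < j \<Longrightarrow> g j = 0 \<or> g i \<le> g j"
  shows "cube_morphism n m (signed_morphism n m g s)"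
proof -
  let ?\<phi> = "signed_morphism n m g s"
  have const: "is_const n ?\<phi> i" if "i \<in> {1..m}" "g i = 0" for i
    unfolding is_const_def signed_morphism_def using that
    by (intro exI[of _ "if s i then 1 else 0"]) simp
  have dep: "depends_as n ?\<phi> i (g i)" if "i \<in> {1..m}" "g i \<noteq> 0" for i
    unfolding depends_as_def signed_morphism_def using that g[of i]
    by (cases "s i") simp_all
  have gam: "gam n ?\<phi> i = g i" if "i \<in> {1..m}" for i
  proof (cases "g i = 0")
    case True
    then show ?thesis using const that by (simp add: gam_def)
  next
    case False
    from dep[OF that False] have "(THE j. depends_as n ?\<phi> i j) = g i"
      by (intro the_equality) (auto intro: depends_as_unique)
    then show ?thesis
      using depends_as_not_const[OF dep[OF that False]] by (simp add: gam_def)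
  qed
  have "?\<phi> v \<in> cube m" if v: "v \<in> cube n" for v
  proof -
    have val: "g i = 0 \<or> v (g i) = 0 \<or> v (g i) = 1" if "i \<in> {1..m}" for i
      using cube_val[OF v, of "g i"] g[OF that] by fastforce
    have "(let t = (if g i = 0 then 0 else v (g i)) in if s i then 1 - t else t) \<in> {0, 1}"
      if "i \<in> {1..m}" for i
      using val[OF that] by (auto simp: Let_def)
    then have "(\<lambda>i\<in>{1..m}. let t = (if g i = 0 then 0 else v (g i)) in if s i then 1 - t else t) \<in> cube m"
      by (intro restrict_in_cube) blast
    then show ?thesis
      unfolding signed_morphism_def using v by simp
  qed
  then have "?\<phi> \<in> cube n \<rightarrow>\<^sub>E cube m"
    unfolding signed_morphism_def by auto
  moreover have "\<forall>i\<in>{1..m}. is_const n ?\<phi> i \<or> (\<exists>j. depends_as n ?\<phi> i j)"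
    using const dep by blast
  ultimately show ?thesis
    unfolding cube_morphism_def using gam mono by auto
qed

section \<open>Coordinates on the 2-cube and the 3-cube\<close>

lemma index_set_2: "{Suc 0..2} = {Suc 0, 2}"
  and index_set_3: "{Suc 0..3} = {Suc 0, 2, 3}"
  by auto

definition square_map :: "'a \<Rightarrow> 'a \<Rightarrow> 'a \<Rightarrow> 'a \<Rightarrow> (nat \<Rightarrow> nat) \<Rightarrow> 'a" where
  "square_map a b c d = (\<lambda>v\<in>cube 2.
     if v 1 = 0 then (if v 2 = 0 then a else c) else (if v 2 = 0 then b else d))"

definition vertex2 :: "nat \<Rightarrow> nat \<Rightarrow> nat \<Rightarrow> nat" where
  "vertex2 x y = (\<lambda>i\<in>{1..2}. if i = 1 then x else y)"

definition vertex3 :: "nat \<Rightarrow> nat \<Rightarrow> nat \<Rightarrow> nat \<Rightarrow> nat" where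
  "vertex3 x y z = (\<lambda>i\<in>{1..3}. if i = 1 then x else if i = 2 then y else z)"

lemma vertex2_in: "x \<in> {0,1} \<Longrightarrow> y \<in> {0,1} \<Longrightarrow> vertex2 x y \<in> cube 2"
  unfolding vertex2_def by (rule restrict_in_cube) auto

lemma vertex3_in: "x \<in> {0,1} \<Longrightarrow> y \<in> {0,1} \<Longrightarrow> z \<in> {0,1} \<Longrightarrow> vertex3 x y z \<in> cube 3"
  unfolding vertex3_def by (rule restrict_in_cube) auto

lemma vertex2_app [simp]: "vertex2 x y (Suc 0) = x" "vertex2 x y 2 = y"
  by (simp_all add: vertex2_def)

lemma vertex3_app [simp]:
  "vertex3 x y z (Suc 0) = x" "vertex3 x y z 2 = y" "vertex3 x y z 3 = z"
  by (simp_all add: vertex3_def)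

lemma cube2_cases:
  assumes "v \<in> cube 2"
  obtains x y where "x \<in> {0,1}" "y \<in> {0,1}" "v = vertex2 x y"
proof -
  have i: "i = 1 \<or> i = 2" if "i \<in> {1..2}" for i :: nat using that by force
  have v12: "v 1 \<in> {0,1}" "v 2 \<in> {0,1}" using cube_val[OF assms] by auto
  have "v = vertex2 (v 1) (v 2)"
    using assms vertex2_in[OF v12] by (rule cube_eqI) (use i in fastforce)
  with v12 that show thesis by blast
qed

lemma vertex2_eq_all_one: "vertex2 x y = all_one 2 \<longleftrightarrow> x = 1 \<and> y = 1"
proof
  assume "vertex2 x y = all_one 2"
  then have "vertex2 x y i = all_one 2 i" for i by simp
  from this[of 1] this[of 2] show "x = 1 \<and> y = 1"
    by (simp add: all_one_def)
qed (auto simp: vertex2_def all_one_def)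

lemma punctured_cube2_cases:
  assumes "v \<in> punctured_cube 2"
  obtains x y where "x \<in> {0,1}" "y \<in> {0,1}" "\<not> (x = 1 \<and> y = 1)" "v = vertex2 x y"
proof -
  have "v \<in> cube 2" "v \<noteq> all_one 2" using assms by (auto simp: punctured_cube_def)
  then show thesis using that vertex2_eq_all_one cube2_cases by metis
qed

lemma face_vertex2:
  assumes "x \<in> {0,1}" "y \<in> {0,1}"
  shows "face 3 1 j (vertex2 x y) = vertex3 j x y"
    "face 3 2 j (vertex2 x y) = vertex3 x j y"
    "face 3 3 j (vertex2 x y) = vertex3 x y j"
proof -
  have i: "i = 1 \<or> i = 2 \<or> i = 3" if "i \<in> {1..3}" for i :: nat using that by force
  have two: "(3 :: nat) - Suc 0 = 2" by simp
  show "face 3 1 j (vertex2 x y) = vertex3 j x y"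
    "face 3 2 j (vertex2 x y) = vertex3 x j y"
    "face 3 3 j (vertex2 x y) = vertex3 x y j"
    unfolding face_def vertex3_def using vertex2_in[OF assms]
    by (auto simp: two fun_eq_iff restrict_def) (use i in fastforce)+
qed

lemma vertex3_eq_all_one: "vertex3 x y z = all_one 3 \<longleftrightarrow> x = 1 \<and> y = 1 \<and> z = 1"
proof
  assume "vertex3 x y z = all_one 3"
  then have "vertex3 x y z i = all_one 3 i" for i by simp
  from this[of 1] this[of 2] this[of 3] show "x = 1 \<and> y = 1 \<and> z = 1"
    by (simp add: all_one_def)
qed (auto simp: vertex3_def all_one_def)

text \<open>Coordinate \<open>i\<close> of the image is 0, so the all-one vertex is never hit; hence
  a map defined off that vertex can be composed with these faces.\<close>

lemma face_in_punctured_cube: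
  assumes "i \<in> {1..n}" "x \<in> cube (n - 1)"
  shows "face n i 0 x \<in> punctured_cube n"
proof -
  have val: "x l = 0 \<or> x l = Suc 0" if "l \<ge> 1" "l \<le> n - 1" for l
    using cube_val_Suc_0[OF assms(2), of l] that by simp
  have "face n i 0 x \<in> cube n"
    unfolding face_def restrict_apply'[OF assms(2)]
  proof (rule restrict_in_cube)
    fix l assume "l \<in> {1..n}"
    then show "(if l < i then x l else if l = i then 0 else x (l - 1)) = 0 \<or>
        (if l < i then x l else if l = i then 0 else x (l - 1)) = 1"
      using val[of l] val[of "l - 1"] assms(1) by auto
  qed
  moreover have "face n i 0 x i \<noteq> all_one n i"
    unfolding face_def all_one_def using assms by simp
  ultimately show ?thesis unfolding punctured_cube_def by auto
qed

section \<open>Squares in a groupspace\<close>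

context groupspace
begin

definition is_square :: "'a \<Rightarrow> 'a \<Rightarrow> 'a \<Rightarrow> 'a \<Rightarrow> bool" where
  "is_square a b c d \<longleftrightarrow> square_map a b c d \<in> C 2"

lemma is_square_in_X:
  assumes "is_square a b c d"
  shows "a \<in> X" "b \<in> X" "c \<in> X" "d \<in> X"
proof -
  have "square_map a b c d v \<in> X" if "v \<in> cube 2" for v
    using assms cubes_subset that unfolding is_square_def by blast
  from this[of "vertex2 0 0"] this[of "vertex2 1 0"] this[of "vertex2 0 1"] this[of "vertex2 1 1"]
  show "a \<in> X" "b \<in> X" "c \<in> X" "d \<in> X"
    by (simp_all add: square_map_def vertex2_in)
qed

text \<open>Squares inside a larger cube \<open>F\<close>, possibly degenerate or diagonal, are read
  off by choosing an index map and signs.\<close>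

lemma is_square_sub:
  assumes F: "F \<in> C m"
    and g: "\<And>i. i \<in> {1..m} \<Longrightarrow> g i \<le> 2"
    and mono: "\<And>i j. i \<in> {1..m} \<Longrightarrow> j \<in> {1..m} \<Longrightarrow> i < j \<Longrightarrow> g j = 0 \<or> g i \<le> g j"
  shows "is_square (F (signed_morphism 2 m g s (vertex2 0 0)))
    (F (signed_morphism 2 m g s (vertex2 1 0)))
    (F (signed_morphism 2 m g s (vertex2 0 1)))
    (F (signed_morphism 2 m g s (vertex2 1 1)))" (is "is_square ?a ?b ?c ?d")
proof -
  have "compose (cube 2) F (signed_morphism 2 m g s) \<in> C 2"
    by (rule presheaf[OF F signed_morphism_is_morphism]) (use g mono in blast)+
  moreover have "compose (cube 2) F (signed_morphism 2 m g s) = square_map ?a ?b ?c ?d"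
    unfolding compose_def square_map_def
    by (rule restrict_ext, erule cube2_cases) auto
  ultimately show ?thesis unfolding is_square_def by simp
qed

text \<open>Pull back along the identity index map with one sign reversed. Exchanging the two
  coordinates breaks the order condition on morphisms, so a transposed square is not obtained this
  way.\<close>

lemma is_square_reflect_1: "is_square a b c d \<Longrightarrow> is_square b a d c"
  and is_square_reflect_2: "is_square a b c d \<Longrightarrow> is_square c d a b"
proof -
  have m: "signed_morphism 2 2 (\<lambda>i. i) s (vertex2 x y) =
      vertex2 (if s 1 then 1 - x else x) (if s 2 then 1 - y else y)"
    if "x \<in> {0,1}" "y \<in> {0,1}" for s x y
    unfolding signed_morphism_def restrict_apply'[OF vertex2_in[OF that]]
      vertex2_def[of "if s 1 then 1 - x else x"]
    by (rule restrict_ext) (auto simp: index_set_2 Let_def)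
  assume "is_square a b c d"
  then have sq: "square_map a b c d \<in> C 2" by (simp add: is_square_def)
  show "is_square b a d c"
    using is_square_sub[OF sq, of "\<lambda>i. i" "\<lambda>i. i = 1"] by (simp add: m square_map_def vertex2_in)
  show "is_square c d a b"
    using is_square_sub[OF sq, of "\<lambda>i. i" "\<lambda>i. i = 2"] by (simp add: m square_map_def vertex2_in)
qed

text \<open>By ergodicity any two points span a 1-cube; its pullbacks along the two coordinate
  projections of the square are these degenerate squares.\<close>

lemma is_square_degenerate:
  assumes "a \<in> X" "b \<in> X"
  shows "is_square a b a b" "is_square a a b b"
proof -
  define F where "F = (\<lambda>v\<in>cube 1. if v 1 = 0 then a else b)"
  have F: "F \<in> C 1" unfolding ergodicity F_def using assms by auto
  have m: "signed_morphism 2 1 (\<lambda>_. j) (\<lambda>_. False) (vertex2 x y) = (\<lambda>i\<in>{1..1}. vertex2 x y j)"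
    if "x \<in> {0,1}" "y \<in> {0,1}" "j \<in> {1,2}" for j x y
    unfolding signed_morphism_def using vertex2_in[OF that(1,2)] that by (auto simp: fun_eq_iff)
  have v: "F (\<lambda>i\<in>{1..1}. x) = (if x = 0 then a else b)" if "x \<in> {0,1}" for x
    unfolding F_def using that restrict_in_cube[of 1 "\<lambda>_. x"] by auto
  have v: "F (\<lambda>i\<in>{Suc 0}. x) = (if x = 0 then a else b)" if "x \<in> {0,Suc 0}" for x
    using v[of x] that by simp
  show "is_square a b a b"
    using is_square_sub[OF F, of "\<lambda>_. 1" "\<lambda>_. False"] m[of _ _ 1] by (simp add: v)
  show "is_square a a b b"
    using is_square_sub[OF F, of "\<lambda>_. 2" "\<lambda>_. False"] m[of _ _ 2] by (simp add: v)
qed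

text \<open>A constant 1-cube, available by ergodicity, is pulled back along a map from the
  one-point cube.\<close>

lemma const_in_C0:
  assumes "x \<in> X"
  shows "(\<lambda>v\<in>cube 0. x) \<in> C 0"
proof -
  have "(\<lambda>v\<in>cube 1. x) \<in> C 1" unfolding ergodicity using assms by auto
  from presheaf[OF this signed_morphism_is_morphism[of 1 "\<lambda>_. 0" 0 "\<lambda>_. False"]]
  have "compose (cube 0) (\<lambda>v\<in>cube 1. x) (signed_morphism 0 1 (\<lambda>_. 0) (\<lambda>_. False)) \<in> C 0"
    by simp
  moreover have "compose (cube 0) (\<lambda>v\<in>cube 1. x) (signed_morphism 0 1 (\<lambda>_. 0) (\<lambda>_. False))
      = (\<lambda>v\<in>cube 0. x)"
    unfolding compose_def
  proof (rule restrict_ext)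
    fix v assume "v \<in> cube 0"
    then have "signed_morphism 0 1 (\<lambda>_. 0) (\<lambda>_. False) v \<in> cube 1"
      unfolding signed_morphism_def using restrict_in_cube[of 1 "\<lambda>_. 0"] by simp
    then show "(\<lambda>v\<in>cube 1. x) (signed_morphism 0 1 (\<lambda>_. 0) (\<lambda>_. False) v) = x" by simp
  qed
  ultimately show ?thesis by simp
qed

text \<open>In dimension 0 the only vertex is \<open>all_one 0\<close>, so the map with empty domain
  is a corner with no faces to check; its completion has a value in \<open>X\<close>.\<close>

lemma nonempty: "X \<noteq> {}"
proof -
  have "corner 0 (\<lambda>_. undefined)"
    unfolding corner_def punctured_cube_def cube_def all_one_def by auto
  then obtain \<phi> where "\<phi> \<in> C 0" using completion unfolding completes_def by blast
  then have "\<phi> \<in> cube 0 \<rightarrow>\<^sub>E X" using cubes_subset by blast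
  moreover have "(\<lambda>_. undefined) \<in> cube 0" unfolding cube_def by auto
  ultimately show ?thesis by auto
qed

section \<open>Faces, and completion of corners in dimensions 2 and 3\<close>

lemma face_in_C:
  assumes "F \<in> C n" "i \<in> {1..n}"
  shows "compose (cube (n - 1)) F (face n i 0) \<in> C (n - 1)"
proof -
  \<comment> \<open>Index 0 makes coordinate \<open>i\<close> the constant 0; the indices after it
    shift down by one.\<close>
  define g where "g l = (if l < i then l else if l = i then 0 else l - 1)" for l
  have "face n i 0 = signed_morphism (n - 1) n g (\<lambda>_. False)"
    unfolding face_def signed_morphism_def
    by (rule restrict_ext, rule restrict_ext) (use assms(2) in \<open>auto simp: g_def\<close>)
  moreover have "cube_morphism (n - 1) n (signed_morphism (n - 1) n g (\<lambda>_. False))"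
    using assms(2) by (intro signed_morphism_is_morphism) (auto simp: g_def)
  ultimately show ?thesis using presheaf[OF assms(1)] by simp
qed

text \<open>The faces are 1-cubes, and by ergodicity every map from the 1-cube to \<open>X\<close>
  is one. The restriction removes the vertex carrying \<open>d\<close>, so \<open>d\<close> is
  arbitrary.\<close>

lemma corner2:
  assumes "a \<in> X" "b \<in> X" "c \<in> X"
  shows "corner 2 (restrict (square_map a b c d) (punctured_cube 2))"
  unfolding corner_def
proof (intro conjI ballI)
  show "restrict (square_map a b c d) (punctured_cube 2) \<in> punctured_cube 2 \<rightarrow>\<^sub>E X"
  proof (rule restrict_PiE_iff[THEN iffD2], rule ballI)
    fix v assume v: "v \<in> punctured_cube 2"
    then show "square_map a b c d v \<in> X"
      by (rule punctured_cube2_cases) (use assms in \<open>auto simp: square_map_def vertex2_in\<close>)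
  qed
  then have *: "restrict (square_map a b c d) (punctured_cube 2) v \<in> X" if "v \<in> punctured_cube 2" for v
    using that by blast
  fix i :: nat assume "i \<in> {1..2}"
  have "compose (cube 1) (restrict (square_map a b c d) (punctured_cube 2)) (face 2 i 0) \<in> C 1"
    unfolding ergodicity compose_def
    using * face_in_punctured_cube[OF \<open>i \<in> {1..2}\<close>] by simp
  then show "compose (cube (2 - 1)) (restrict (square_map a b c d) (punctured_cube 2)) (face 2 i 0)
      \<in> C (2 - 1)" by simp
qed

text \<open>The corner is the same for every \<open>x\<close>, so two squares with common
  \<open>a\<close>, \<open>b\<close>, \<open>c\<close> complete one corner.\<close>

lemma completes_square_map:
  "is_square a b c d \<Longrightarrow> completes 2 (restrict (square_map a b c x) (punctured_cube 2)) (square_map a b c d)"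
  unfolding completes_def is_square_def
proof (intro conjI restrict_ext)
  fix v assume v: "v \<in> punctured_cube 2"
  then show "square_map a b c d v = square_map a b c x v"
    by (rule punctured_cube2_cases) (auto simp: square_map_def)
qed

lemma is_square_exists:
  assumes "a \<in> X" "b \<in> X" "c \<in> X"
  obtains d where "is_square a b c d"
proof -
  obtain \<phi> where \<phi>: "\<phi> \<in> C 2"
      "restrict \<phi> (punctured_cube 2) = restrict (square_map a b c a) (punctured_cube 2)"
    using completion[OF corner2[OF assms]] unfolding completes_def by blast
  have val: "\<phi> (vertex2 x y) = square_map a b c a (vertex2 x y)"
    if "x \<in> {0,1}" "y \<in> {0,1}" "\<not> (x = 1 \<and> y = 1)" for x y
  proof -
    have "vertex2 x y \<in> punctured_cube 2"
      using vertex2_in[OF that(1,2)] that(3) by (simp add: punctured_cube_def vertex2_eq_all_one)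
    then show ?thesis using \<phi>(2) by (metis restrict_apply')
  qed
  have "\<phi> = square_map a b c (\<phi> (vertex2 1 1))"
  proof (rule extensionalityI[of _ "cube 2"])
    show "\<phi> \<in> extensional (cube 2)" using \<phi>(1) cubes_subset by (auto simp: PiE_def)
    fix v assume "v \<in> cube 2"
    then obtain x y where "x \<in> {0,1}" "y \<in> {0,1}" "v = vertex2 x y" by (rule cube2_cases)
    then show "\<phi> v = square_map a b c (\<phi> (vertex2 1 1)) v"
      using val[of x y] by (auto simp: square_map_def vertex2_in)
  qed (simp add: square_map_def)
  then show thesis using that \<phi>(1) unfolding is_square_def by metis
qed

text \<open>Every vertex other than 111 has a zero coordinate and so lies on one of the three given
  squares, which are the faces of a 3-dimensional corner.\<close>

lemma corner3_fill:
  fixes f :: "nat \<Rightarrow> nat \<Rightarrow> nat \<Rightarrow> 'a"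
  assumes "is_square (f 0 0 0) (f 0 1 0) (f 0 0 1) (f 0 1 1)"
    and "is_square (f 0 0 0) (f 1 0 0) (f 0 0 1) (f 1 0 1)"
    and "is_square (f 0 0 0) (f 1 0 0) (f 0 1 0) (f 1 1 0)"
  obtains F where "F \<in> C 3"
    "\<And>x y z. x \<in> {0,1} \<Longrightarrow> y \<in> {0,1} \<Longrightarrow> z \<in> {0,1} \<Longrightarrow> \<not> (x = 1 \<and> y = 1 \<and> z = 1)
      \<Longrightarrow> F (vertex3 x y z) = f x y z"
proof -
  define h where "h = (\<lambda>v\<in>punctured_cube 3. f (v 1) (v 2) (v 3))"
  have mem: "vertex3 x y z \<in> punctured_cube 3"
    if "x \<in> {0,1}" "y \<in> {0,1}" "z \<in> {0,1}" "\<not> (x = 1 \<and> y = 1 \<and> z = 1)" for x y z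
    using vertex3_in[OF that(1-3)] that(4) by (simp add: punctured_cube_def vertex3_eq_all_one)
  have h: "h (vertex3 x y z) = f x y z"
    if "x \<in> {0,1}" "y \<in> {0,1}" "z \<in> {0,1}" "\<not> (x = 1 \<and> y = 1 \<and> z = 1)" for x y z
    unfolding h_def using mem[OF that] by simp
  have three: "i = 1 \<or> i = 2 \<or> i = 3" if "i \<in> {1..3}" for i :: nat using that by force
  have inX: "f x y z \<in> X"
    if "x \<in> {0,1}" "y \<in> {0,1}" "z \<in> {0,1}" "\<not> (x = 1 \<and> y = 1 \<and> z = 1)" for x y z
    using that is_square_in_X[OF assms(1)] is_square_in_X[OF assms(2)] is_square_in_X[OF assms(3)]
    by auto
  have "corner 3 h"
    unfolding corner_def
  proof (intro conjI ballI)
    have "f (v 1) (v 2) (v 3) \<in> X" if "v \<in> punctured_cube 3" for v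
    proof (rule inX)
      have v: "v \<in> cube 3" "v \<noteq> all_one 3" using that by (auto simp: punctured_cube_def)
      show v': "v 1 \<in> {0,1}" "v 2 \<in> {0,1}" "v 3 \<in> {0,1}" using cube_val[OF v(1)] by auto
      have "v = vertex3 (v 1) (v 2) (v 3)"
        using v(1) vertex3_in[OF v'] by (rule cube_eqI) (use three in fastforce)
      then show "\<not> (v 1 = 1 \<and> v 2 = 1 \<and> v 3 = 1)"
        using v(2) vertex3_eq_all_one by metis
    qed
    then show "h \<in> punctured_cube 3 \<rightarrow>\<^sub>E X" unfolding h_def by auto
    have *: "compose (cube 2) h (face 3 1 0) = square_map (f 0 0 0) (f 0 1 0) (f 0 0 1) (f 0 1 1)"
      "compose (cube 2) h (face 3 2 0) = square_map (f 0 0 0) (f 1 0 0) (f 0 0 1) (f 1 0 1)"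
      "compose (cube 2) h (face 3 3 0) = square_map (f 0 0 0) (f 1 0 0) (f 0 1 0) (f 1 1 0)"
      unfolding compose_def square_map_def
      by (rule restrict_ext, erule cube2_cases, use h in \<open>auto simp: face_vertex2 face_vertex2(1)[simplified]\<close>)+
    fix i :: nat assume "i \<in> {1..3}"
    then have "compose (cube 2) h (face 3 i 0) \<in> C 2"
      using * assms by (auto simp: is_square_def index_set_3)
    then show "compose (cube (3 - 1)) h (face 3 i 0) \<in> C (3 - 1)" by simp
  qed
  from completion[OF this] obtain F where F: "F \<in> C 3" "restrict F (punctured_cube 3) = h"
    unfolding completes_def by blast
  show thesis
  proof (rule that[OF F(1)])
    fix x y z :: nat
    assume a: "x \<in> {0,1}" "y \<in> {0,1}" "z \<in> {0,1}" "\<not> (x = 1 \<and> y = 1 \<and> z = 1)"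
    show "F (vertex3 x y z) = f x y z"
      using F(2) mem[OF a] h[OF a] by (metis restrict_apply')
  qed
qed

section \<open>Gluing squares through 3-cubes\<close>

lemma signed_morphism_vertex3:
  assumes "x \<in> {0,1}" "y \<in> {0,1}"
  defines "v \<equiv> vertex2 x y"
  assumes "\<And>i. i \<in> {1,2,3} \<Longrightarrow> g i \<in> {1,2}"
  shows "signed_morphism 2 3 g s v =
    vertex3 (if s 1 then 1 - v (g 1) else v (g 1)) (if s 2 then 1 - v (g 2) else v (g 2))
      (if s 3 then 1 - v (g 3) else v (g 3))"
proof -
  have g0: "g 1 \<noteq> 0" "g 2 \<noteq> 0" "g 3 \<noteq> 0" using assms(4)[of 1] assms(4)[of 2] assms(4)[of 3] by auto
  show ?thesis
    unfolding signed_morphism_def vertex3_def v_def restrict_apply'[OF vertex2_in[OF assms(1,2)]]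
    by (rule restrict_ext) (use g0 in \<open>auto simp: index_set_3 Let_def\<close>)
qed

text \<open>Put the two squares on faces of a 3-cube that meet in the common edge
  \<open>(b, d)\<close>. The diagonal square through the edges \<open>(a, c)\<close> and
  \<open>(g, h)\<close> is the glued one, up to reflection.\<close>

lemma is_square_glue_1:
  assumes "is_square a b c d" "is_square b g d h"
  shows "is_square a g c h"
proof -
  note X = is_square_in_X[OF assms(1)] is_square_in_X[OF assms(2)]
  \<comment> \<open>The square on \<open>b\<close>, \<open>a\<close>, \<open>g\<close> supplies the
    third face; \<open>w\<close> sits at 110, off the diagonal used below.\<close>
  obtain w where w: "is_square b a g w" using is_square_exists X by metis
  define f where "f x y z = (if (x, y) = (0, 0) then if z = 0 then b else d
      else if (x, y) = (0, 1) then if z = 0 then g else h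
      else if (x, y) = (1, 0) then if z = 0 then a else c else w)" for x y z :: nat
  obtain F where F: "F \<in> C 3"
    "\<And>x y z. x \<in> {0,1} \<Longrightarrow> y \<in> {0,1} \<Longrightarrow> z \<in> {0,1} \<Longrightarrow> \<not> (x = 1 \<and> y = 1 \<and> z = 1)
      \<Longrightarrow> F (vertex3 x y z) = f x y z"
    by (rule corner3_fill[of f])
      (use assms(2) w is_square_reflect_1[OF assms(1)] in \<open>simp_all add: f_def\<close>)
  \<comment> \<open>With the sign reversed at 2, this gives the map sending \<open>(x, y)\<close> to
    \<open>(x, 1 - x, y)\<close>, which avoids the vertex 111.\<close>
  define k where "k = (\<lambda>i::nat. if i = 3 then 2 else 1 :: nat)"
  have "is_square g a h c"
    using is_square_sub[OF F(1), of k "\<lambda>i. i = 2"]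
    by (simp add: signed_morphism_vertex3 F(2) k_def f_def)
  then show ?thesis by (rule is_square_reflect_1)
qed

text \<open>The same argument with the common edge \<open>(c, d)\<close> in the first direction. It
  is carried out separately because exchanging coordinates is not a morphism.\<close>

lemma is_square_glue_2:
  assumes "is_square a b c d" "is_square c d p q"
  shows "is_square a b p q"
proof -
  note X = is_square_in_X[OF assms(1)] is_square_in_X[OF assms(2)]
  obtain w where w: "is_square c a p w" using is_square_exists X by metis
  define f where "f x y z = (if (y, z) = (0, 0) then if x = 0 then c else d
      else if (y, z) = (1, 0) then if x = 0 then a else b
      else if (y, z) = (0, 1) then if x = 0 then p else q else w)" for x y z :: nat
  obtain F where F: "F \<in> C 3"
    "\<And>x y z. x \<in> {0,1} \<Longrightarrow> y \<in> {0,1} \<Longrightarrow> z \<in> {0,1} \<Longrightarrow> \<not> (x = 1 \<and> y = 1 \<and> z = 1)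
      \<Longrightarrow> F (vertex3 x y z) = f x y z"
    by (rule corner3_fill[of f])
      (use assms(2) w is_square_reflect_2[OF assms(1)] in \<open>simp_all add: f_def\<close>)
  \<comment> \<open>With the sign reversed at 3, this gives the map sending \<open>(x, y)\<close> to
    \<open>(x, y, 1 - y)\<close>.\<close>
  define k where "k = (\<lambda>i::nat. if i = 1 then 1 else 2 :: nat)"
  have "is_square p q a b"
    using is_square_sub[OF F(1), of k "\<lambda>i. i = 3"]
    by (simp add: signed_morphism_vertex3 F(2) k_def f_def)
  then show ?thesis by (rule is_square_reflect_2)
qed

lemma is_square_edge_sub:
  assumes F: "F \<in> C (Suc n)" and w: "w \<in> cube n"
  defines "ext \<equiv> \<lambda>w t. \<lambda>i\<in>{1..Suc n}. if i \<le> n then w i else t"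
  shows "is_square (F (ext (\<lambda>_. 0) 0)) (F (ext w 0)) (F (ext (\<lambda>_. 0) 1)) (F (ext w 1))"
proof -
  \<comment> \<open>The value \<open>w i\<close>, being 0 or 1, serves as an index: coordinates
    where \<open>w\<close> is 1 follow the first coordinate of the square, the others up to
    \<open>n\<close> stay 0. The last coordinate follows the second.\<close>
  define g where "g i = (if i \<le> n then w i else 2)" for i
  have w01: "w i = 0 \<or> w i = Suc 0" if "i \<in> {1..n}" for i using cube_val_Suc_0[OF w that] .
  have m: "signed_morphism 2 (Suc n) g (\<lambda>_. False) (vertex2 x y) = ext (\<lambda>i. if w i = 0 then 0 else x) y"
    if "x \<in> {0,1}" "y \<in> {0,1}" for x y
    unfolding signed_morphism_def ext_def restrict_apply'[OF vertex2_in[OF that]]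
    by (rule restrict_ext) (use w01 in \<open>fastforce simp: g_def Let_def\<close>)
  have w1: "ext (\<lambda>i. if w i = 0 then 0 else Suc 0) y = ext w y" for y
    unfolding ext_def using w01 by (auto simp: fun_eq_iff restrict_def) (metis Suc_leI not_gr0)
  have "g i \<le> 2" if "i \<in> {1..Suc n}" for i using w01[of i] that by (auto simp: g_def)
  moreover have "g j = 0 \<or> g i \<le> g j" if "i \<in> {1..Suc n}" "j \<in> {1..Suc n}" "i < j" for i j
    using that w01[of i] w01[of j] by (auto simp: g_def)
  ultimately show ?thesis
    using is_square_sub[OF F, of g "\<lambda>_. False"] by (simp add: m w1)
qed

end

section \<open>Ordered products and the cubes of \<open>D1_cubes\<close>\<close>

definition ordered_product :: "('a, 'b) monoid_scheme \<Rightarrow> nat \<Rightarrow> (nat \<Rightarrow> 'a) \<Rightarrow> (nat \<Rightarrow> nat) \<Rightarrow> 'a" where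
  "ordered_product G n a v = a 0 \<otimes>\<^bsub>G\<^esub>
     foldr (\<otimes>\<^bsub>G\<^esub>) (map (\<lambda>i. a i [^]\<^bsub>G\<^esub> v i) [1..<Suc n]) \<one>\<^bsub>G\<^esub>"

lemma D1_cubes_eq:
  "D1_cubes G n = {(\<lambda>v\<in>cube n. ordered_product G n a v) | a. a \<in> {0..n} \<rightarrow> carrier G}"
  unfolding D1_cubes_def ordered_product_def ..

lemma ordered_product_cong:
  assumes "\<And>i. i \<le> n \<Longrightarrow> a i = b i" "\<And>i. 1 \<le> i \<Longrightarrow> i \<le> n \<Longrightarrow> v i = w i"
  shows "ordered_product G n a v = ordered_product G n b w"
proof -
  have "map (\<lambda>i. a i [^]\<^bsub>G\<^esub> v i) [1..<Suc n] = map (\<lambda>i. b i [^]\<^bsub>G\<^esub> w i) [1..<Suc n]"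
    using assms by (intro map_cong) auto
  then show ?thesis unfolding ordered_product_def using assms(1)[of 0] by (simp only:)
qed

context group
begin

lemma foldr_mult_closed: "set xs \<subseteq> carrier G \<Longrightarrow> foldr (\<otimes>) xs \<one> \<in> carrier G"
  by (induction xs) auto

lemma foldr_mult_snoc:
  "set xs \<subseteq> carrier G \<Longrightarrow> y \<in> carrier G \<Longrightarrow> foldr (\<otimes>) (xs @ [y]) \<one> = foldr (\<otimes>) xs \<one> \<otimes> y"
  by (induction xs) (use foldr_mult_closed in \<open>auto simp: m_assoc\<close>)

lemma ordered_product_0: "a 0 \<in> carrier G \<Longrightarrow> ordered_product G 0 a v = a 0"
  by (simp add: ordered_product_def)

text \<open>Increasing index order lets the last factor split off on the right, which drives the
  inductions on the dimension.\<close>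

lemma ordered_product_Suc:
  assumes "a \<in> {0..Suc n} \<rightarrow> carrier G"
  shows "ordered_product G (Suc n) a v = ordered_product G n a v \<otimes> a (Suc n) [^] v (Suc n)"
proof -
  have *: "set (map (\<lambda>i. a i [^] v i) [1..<Suc n]) \<subseteq> carrier G"
    using assms by (auto simp: Pi_iff)
  have "a 0 \<in> carrier G" "a (Suc n) \<in> carrier G" using assms by auto
  then show ?thesis
    unfolding ordered_product_def
    using foldr_mult_snoc[OF *, of "a (Suc n) [^] v (Suc n)"] foldr_mult_closed[OF *]
    by (simp add: m_assoc)
qed

lemma ordered_product_closed:
  "a \<in> {0..n} \<rightarrow> carrier G \<Longrightarrow> ordered_product G n a v \<in> carrier G"
proof (induction n)
  case 0
  then show ?case by (simp add: ordered_product_0 Pi_iff)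
next
  case (Suc n)
  then have "a \<in> {0..n} \<rightarrow> carrier G" "a (Suc n) \<in> carrier G" by auto
  with Suc show ?case by (simp add: ordered_product_Suc)
qed

lemma ordered_product_zero:
  "a \<in> {0..n} \<rightarrow> carrier G \<Longrightarrow> (\<And>i. 1 \<le> i \<Longrightarrow> i \<le> n \<Longrightarrow> v i = 0) \<Longrightarrow> ordered_product G n a v = a 0"
proof (induction n)
  case 0
  then show ?case by (simp add: ordered_product_0 Pi_iff)
next
  case (Suc n)
  then have "a \<in> {0..n} \<rightarrow> carrier G" "a 0 \<in> carrier G" by auto
  with Suc show ?case by (simp add: ordered_product_Suc)
qed

text \<open>As \<open>a i [^] v i\<close> is \<open>\<one>\<close>, this factor can be deleted and
  the later indices shifted down; \<open>1 \<le> i\<close> keeps \<open>a 0\<close> in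
  place.\<close>

lemma ordered_product_skip:
  assumes "a \<in> {0..Suc n} \<rightarrow> carrier G" "1 \<le> i" "i \<le> Suc n" "v i = 0"
  shows "ordered_product G (Suc n) a v =
    ordered_product G n (\<lambda>k. if k < i then a k else a (Suc k)) (\<lambda>k. if k < i then v k else v (Suc k))"
  using assms
proof (induction n)
  case 0
  then have "i = 1" "a 0 \<in> carrier G" "a 1 \<in> carrier G" by (auto simp: Pi_iff)
  with 0 show ?case by (simp add: ordered_product_0 ordered_product_Suc)
next
  case (Suc n)
  have a: "a \<in> {0..Suc n} \<rightarrow> carrier G" using Suc.prems(1) by auto
  have a': "(\<lambda>k. if k < i then a k else a (Suc k)) \<in> {0..Suc n} \<rightarrow> carrier G"
    using Suc.prems(1) by (auto simp: Pi_iff)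
  show ?case
  proof (cases "i = Suc (Suc n)")
    case True
    have "ordered_product G (Suc (Suc n)) a v = ordered_product G (Suc n) a v"
      using Suc.prems(1,4) True ordered_product_closed[OF a] by (simp add: ordered_product_Suc)
    also have "\<dots> = ordered_product G (Suc n) (\<lambda>k. if k < i then a k else a (Suc k))
        (\<lambda>k. if k < i then v k else v (Suc k))"
      by (rule ordered_product_cong) (use True in auto)
    finally show ?thesis .
  next
    case False
    then have "ordered_product G (Suc n) a v = ordered_product G n
        (\<lambda>k. if k < i then a k else a (Suc k)) (\<lambda>k. if k < i then v k else v (Suc k))"
      using Suc.IH[OF a] Suc.prems by simp
    then show ?thesis
      unfolding ordered_product_Suc[OF a'] ordered_product_Suc[OF Suc.prems(1)]
      using False Suc.prems(3) by simp
  qed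
qed

text \<open>On the face the \<open>i\<close>-th factor is trivial, so its coefficient can be
  omitted. This supplies the corners completed in \<open>D1_subset_C\<close>.\<close>

lemma D1_cubes_face:
  assumes d: "d \<in> D1_cubes G (Suc n)" and i: "i \<in> {1..Suc n}"
  shows "compose (cube n) d (face (Suc n) i 0) \<in> D1_cubes G n"
proof -
  obtain a where a: "a \<in> {0..Suc n} \<rightarrow> carrier G"
    and d: "d = (\<lambda>v\<in>cube (Suc n). ordered_product G (Suc n) a v)"
    using d unfolding D1_cubes_eq by blast
  let ?a = "\<lambda>k. if k < i then a k else a (Suc k)"
  have "compose (cube n) d (face (Suc n) i 0) = (\<lambda>x\<in>cube n. ordered_product G n ?a x)"
    unfolding compose_def
  proof (rule restrict_ext)
    fix x assume x: "x \<in> cube n"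
    define v where "v = face (Suc n) i 0 x"
    have "v \<in> cube (Suc n)"
      using face_in_punctured_cube[OF i, of x] x by (simp add: v_def punctured_cube_def)
    moreover have "v i = 0" using i x by (simp add: v_def face_def)
    ultimately have "d v = ordered_product G n ?a (\<lambda>k. if k < i then v k else v (Suc k))"
      unfolding d using ordered_product_skip[OF a, of i v] i by simp
    also have "\<dots> = ordered_product G n ?a x"
      by (rule ordered_product_cong) (use i x in \<open>auto simp: v_def face_def\<close>)
    finally show "d (face (Suc n) i 0 x) = ordered_product G n ?a x" unfolding v_def .
  qed
  moreover have "?a \<in> {0..n} \<rightarrow> carrier G" using a by (auto simp: Pi_iff)
  ultimately show ?thesis unfolding D1_cubes_eq by blast
qed

text \<open>Three vertices determine the value at \<open>all_one n\<close>: the origin gives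
  \<open>a 0\<close>, the last unit vector then gives \<open>a n\<close>, and the vertex with only
  its last coordinate 0 gives the product of all earlier factors. For \<open>2 \<le> n\<close> none
  of them is \<open>all_one n\<close>.\<close>

lemma D1_cubes_eqI:
  assumes c: "c \<in> D1_cubes G n" and d: "d \<in> D1_cubes G n" and n: "2 \<le> n"
    and eq: "restrict c (punctured_cube n) = restrict d (punctured_cube n)"
  shows "c = d"
proof -
  obtain m where m: "n = Suc m" "1 \<le> m" using n by (cases n) auto
  obtain a b where a: "a \<in> {0..n} \<rightarrow> carrier G" "c = (\<lambda>v\<in>cube n. ordered_product G n a v)"
    and b: "b \<in> {0..n} \<rightarrow> carrier G" "d = (\<lambda>v\<in>cube n. ordered_product G n b v)"
    using c d unfolding D1_cubes_eq by blast
  have eqv: "c v = d v" if "v \<in> cube n" "v \<noteq> all_one n" for v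
  proof -
    have "v \<in> punctured_cube n" using that by (simp add: punctured_cube_def)
    then show ?thesis using eq by (metis restrict_apply')
  qed
  let ?v = "\<lambda>s t. \<lambda>i\<in>{1..n}. if i \<le> m then s else t :: nat"
  have v_in: "?v s t \<in> cube n" if "s \<in> {0,1}" "t \<in> {0,1}" for s t
    using that by (intro restrict_in_cube) auto
  have v_eq: "ordered_product G n a (?v s t) = ordered_product G n b (?v s t)"
    if "s \<in> {0,1}" "t \<in> {0,1}" "s = 0 \<or> t = 0" for s t
  proof -
    have "?v s t \<noteq> all_one n"
    proof
      assume *: "?v s t = all_one n"
      show False using fun_cong[OF *, of 1] fun_cong[OF *, of n] m that(3)
        by (auto simp: all_one_def)
    qed
    with eqv[OF v_in[OF that(1,2)]] v_in[OF that(1,2)] show ?thesis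
      unfolding a(2) b(2) by simp
  qed
  have a': "a \<in> {0..m} \<rightarrow> carrier G" "a n \<in> carrier G" "a 0 \<in> carrier G"
    and b': "b \<in> {0..m} \<rightarrow> carrier G" "b n \<in> carrier G" "b 0 \<in> carrier G"
    using a(1) b(1) m by auto
  have split: "ordered_product G n f (?v s t) = ordered_product G m f (\<lambda>_. s) \<otimes> f n [^] t"
    if "f \<in> {0..n} \<rightarrow> carrier G" for f s t
  proof -
    have "ordered_product G m f (?v s t) = ordered_product G m f (\<lambda>_. s)"
      using m by (intro ordered_product_cong) auto
    then show ?thesis using ordered_product_Suc[of f m "?v s t"] that m by simp
  qed
  have zero: "ordered_product G m f (\<lambda>_. 0) = f 0" if "f \<in> {0..n} \<rightarrow> carrier G" for f
    using that m by (intro ordered_product_zero) auto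
  have "a 0 = b 0"
    using v_eq[of 0 0, unfolded split[OF a(1)] split[OF b(1)] zero[OF a(1)] zero[OF b(1)]] a' b' by simp
  moreover have "a 0 \<otimes> a n = b 0 \<otimes> b n"
    using v_eq[of 0 1, unfolded split[OF a(1)] split[OF b(1)] zero[OF a(1)] zero[OF b(1)]] a' b' by simp
  ultimately have "a n = b n" using a' b' by simp
  moreover have "ordered_product G m a (\<lambda>_. 1) = ordered_product G m b (\<lambda>_. 1)"
    using v_eq[of 1 0, unfolded split[OF a(1)] split[OF b(1)]] a' b'
    by (simp add: ordered_product_closed)
  ultimately have "ordered_product G n a (?v 1 1) = ordered_product G n b (?v 1 1)"
    by (simp only: split[OF a(1)] split[OF b(1)])
  moreover have "all_one n = ?v 1 1" by (auto simp: all_one_def)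
  ultimately have "c (all_one n) = d (all_one n)" unfolding a(2) b(2) by simp
  with eqv have "c v = d v" if "v \<in> cube n" for v using that by metis
  then show ?thesis unfolding a(2) b(2) by (metis (no_types, lifting) restrict_apply' restrict_ext)
qed

end

section \<open>The group of translations\<close>

locale pointed_one_step_groupspace = step_groupspace 1 X C
  for X :: "'a set" and C :: "nat \<Rightarrow> ((nat \<Rightarrow> nat) \<Rightarrow> 'a) set" +
  fixes e :: 'a
  assumes e_in: "e \<in> X"
begin

text \<open>Both squares complete one 2-dimensional corner, and 1-step means uniqueness in dimension
  1 + 1.\<close>

lemma is_square_unique:
  assumes "is_square a b c d" "is_square a b c d'"
  shows "d = d'"
proof -
  note X = is_square_in_X[OF assms(1)]
  have "\<exists>!\<phi>. completes 2 (restrict (square_map a b c a) (punctured_cube 2)) \<phi>"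
    using unique_completion corner2[OF X(1-3)] by (simp only: one_add_one)
  then have "square_map a b c d = square_map a b c d'"
    using completes_square_map[OF assms(1)] completes_square_map[OF assms(2)] by blast
  from fun_cong[OF this, of "vertex2 1 1"] show ?thesis
    by (simp add: square_map_def vertex2_in)
qed

definition times :: "'a \<Rightarrow> 'a \<Rightarrow> 'a" where
  "times x y = (THE z. is_square e x y z)"

definition translation_group :: "'a monoid" where
  "translation_group = \<lparr>carrier = X, mult = times, one = e\<rparr>"

lemma times_eqI: "is_square e x y z \<Longrightarrow> times x y = z"
  unfolding times_def using is_square_unique by blast

lemma is_square_times:
  assumes "x \<in> X" "y \<in> X"
  shows "is_square e x y (times x y)"
proof -
  obtain z where "is_square e x y z" using is_square_exists e_in assms by blast
  with times_eqI show ?thesis by metis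
qed

lemma translation_group_group: "group translation_group"
proof (rule groupI)
  fix x y z
  assume "x \<in> carrier translation_group" "y \<in> carrier translation_group" "z \<in> carrier translation_group"
  then have X: "x \<in> X" "y \<in> X" "z \<in> X" by (auto simp: translation_group_def)
  have xy: "is_square e x y (times x y)" and yz: "is_square e y z (times y z)"
    using X is_square_times by auto
  \<comment> \<open>Associativity by gluing: this square shares the edge \<open>(e, z)\<close> with
    the square for \<open>times y z\<close>, and the result shares the edge
    \<open>(y, times x y)\<close> with the square for \<open>times x y\<close>. The final square
    starts with \<open>e\<close>, \<open>x\<close>, \<open>times y z\<close>.\<close>
  have "is_square e (times x y) z (times (times x y) z)"
    using is_square_times is_square_in_X(4)[OF xy] X by blast
  then have "is_square y (times x y) (times y z) (times (times x y) z)"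
    using yz is_square_reflect_1 is_square_glue_1 by blast
  then have "is_square e x (times y z) (times (times x y) z)"
    using xy is_square_glue_2 by blast
  from times_eqI[OF this]
  show "x \<otimes>\<^bsub>translation_group\<^esub> y \<otimes>\<^bsub>translation_group\<^esub> z =
      x \<otimes>\<^bsub>translation_group\<^esub> (y \<otimes>\<^bsub>translation_group\<^esub> z)"
    by (simp add: translation_group_def)
next
  fix x assume "x \<in> carrier translation_group"
  then have x: "x \<in> X" by (simp add: translation_group_def)
  show "\<one>\<^bsub>translation_group\<^esub> \<otimes>\<^bsub>translation_group\<^esub> x = x"
    using times_eqI is_square_degenerate(2)[OF e_in x] by (simp add: translation_group_def)
  \<comment> \<open>Reflected in the second direction, this square has values \<open>e\<close>,
    \<open>y\<close>, \<open>x\<close>, \<open>e\<close>, which exhibits \<open>y\<close> as a left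
    inverse of \<open>x\<close>.\<close>
  obtain y where "is_square x e e y" using is_square_exists x e_in by blast
  then have "is_square e y x e" "y \<in> X" using is_square_reflect_2 is_square_in_X by blast+
  then show "\<exists>y\<in>carrier translation_group. y \<otimes>\<^bsub>translation_group\<^esub> x = \<one>\<^bsub>translation_group\<^esub>"
    using times_eqI by (auto simp: translation_group_def)
qed (use is_square_in_X(4)[OF is_square_times] e_in in \<open>auto simp: translation_group_def\<close>)

section \<open>Identification of the cubes\<close>

interpretation G: group translation_group
  by (rule translation_group_group)

text \<open>Choose \<open>t\<close> with \<open>c = times a t\<close>. Gluing the square
  \<open>e\<close>, \<open>a\<close>, \<open>t\<close>, \<open>c\<close> to the given one yields the
  square \<open>e\<close>, \<open>b\<close>, \<open>t\<close>, \<open>d\<close>, so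
  \<open>d = times b t\<close>: both edges are right translation by \<open>t\<close>.\<close>

lemma is_square_imp_translate:
  assumes "is_square a b c d"
  shows "d = b \<otimes>\<^bsub>translation_group\<^esub> (inv\<^bsub>translation_group\<^esub> a \<otimes>\<^bsub>translation_group\<^esub> c)"
proof -
  note X = is_square_in_X[OF assms]
  obtain t where "is_square a e c t" using is_square_exists X e_in by blast
  then have t: "is_square e a t c" and tX: "t \<in> X" using is_square_reflect_1 is_square_in_X by blast+
  have "c = times a t" using times_eqI[OF t] by simp
  moreover have "d = times b t" using times_eqI[OF is_square_glue_1[OF t assms]] by simp
  ultimately have "c = a \<otimes>\<^bsub>translation_group\<^esub> t" "d = b \<otimes>\<^bsub>translation_group\<^esub> t"
    by (simp_all add: translation_group_def)
  moreover have "a \<in> carrier translation_group" "t \<in> carrier translation_group"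
    using X tX by (simp_all add: translation_group_def)
  ultimately show ?thesis by (simp add: G.m_assoc[symmetric])
qed

lemma carrier_translation_group [simp]: "carrier translation_group = X"
  by (simp add: translation_group_def)

lemma C_subset_D1: "c \<in> C n \<Longrightarrow> c \<in> D1_cubes translation_group n"
proof (induction n arbitrary: c)
  case 0
  let ?o = "\<lambda>_. undefined"
  have cube0: "cube 0 = {?o}" by (simp add: cube_def)
  have c: "c \<in> cube 0 \<rightarrow>\<^sub>E X" using 0 cubes_subset by blast
  then have "c ?o \<in> X" by (auto simp: cube0)
  then have "c = (\<lambda>v\<in>cube 0. ordered_product translation_group 0 (\<lambda>_. c ?o) v)"
    using c by (intro PiE_ext[OF c]) (auto simp: cube0 G.ordered_product_0)
  with \<open>c ?o \<in> X\<close> show ?case unfolding D1_cubes_eq by (intro CollectI exI[of _ "\<lambda>_. c ?o"]) simp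
next
  case (Suc n)
  let ?G = translation_group
  let ?ext = "\<lambda>w t. \<lambda>i\<in>{1..Suc n}. if i \<le> n then w i else t :: nat"
  have cX: "c \<in> cube (Suc n) \<rightarrow>\<^sub>E X" using Suc.prems cubes_subset by blast
  have ext_in: "?ext w t \<in> cube (Suc n)" if "\<And>i. i \<in> {1..n} \<Longrightarrow> w i \<in> {0,1}" "t \<in> {0,1}" for w t
    by (rule restrict_in_cube) (use that in auto)
  \<comment> \<open>The face with last coordinate 0 has the required form by induction and supplies
    the coefficients up to \<open>n\<close>.\<close>
  have "compose (cube n) c (face (Suc n) (Suc n) 0) \<in> D1_cubes ?G n"
    using Suc.IH face_in_C[OF Suc.prems, of "Suc n"] by simp
  then obtain a where a: "a \<in> {0..n} \<rightarrow> X"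
    and ca: "compose (cube n) c (face (Suc n) (Suc n) 0) = (\<lambda>v\<in>cube n. ordered_product ?G n a v)"
    unfolding D1_cubes_eq by auto
  have low: "c (?ext w 0) = ordered_product ?G n a w" if "w \<in> cube n" for w
  proof -
    have "face (Suc n) (Suc n) 0 w = ?ext w 0"
      using that by (auto simp: face_def fun_eq_iff restrict_def)
    then show ?thesis using fun_cong[OF ca, of w] that by (simp add: compose_def)
  qed
  \<comment> \<open>The last coefficient is the right translation along the edge over the
    origin.\<close>
  define t where "t = inv\<^bsub>?G\<^esub> c (?ext (\<lambda>_. 0) 0) \<otimes>\<^bsub>?G\<^esub> c (?ext (\<lambda>_. 0) 1)"
  have "c (?ext (\<lambda>_. 0) 0) \<in> X" "c (?ext (\<lambda>_. 0) 1) \<in> X"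
    using PiE_mem[OF cX ext_in[of "\<lambda>_. 0" 0]] PiE_mem[OF cX ext_in[of "\<lambda>_. 0" 1]] by auto
  then have t: "t \<in> X" unfolding t_def
    using G.m_closed G.inv_closed by (metis carrier_translation_group)
  have high: "c (?ext w 1) = ordered_product ?G n a w \<otimes>\<^bsub>?G\<^esub> t" if "w \<in> cube n" for w
  proof -
    have "is_square (c (?ext (\<lambda>_. 0) 0)) (c (?ext w 0)) (c (?ext (\<lambda>_. 0) 1)) (c (?ext w 1))"
      by (rule is_square_edge_sub[OF Suc.prems that])
    from is_square_imp_translate[OF this] show ?thesis
      unfolding t_def low[OF that] .
  qed
  define a' where "a' = a(Suc n := t)"
  have a': "a' \<in> {0..Suc n} \<rightarrow> X" unfolding a'_def using a t by auto
  have "c = (\<lambda>v\<in>cube (Suc n). ordered_product ?G (Suc n) a' v)"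
  proof (rule extensionalityI[of _ "cube (Suc n)"])
    show "c \<in> extensional (cube (Suc n))" using cX by (auto simp: PiE_def)
    fix v assume v: "v \<in> cube (Suc n)"
    define w where "w = restrict v {1..n}"
    have w: "w \<in> cube n" unfolding w_def using cube_val[OF v] by (intro restrict_in_cube) auto
    have "?ext w (v (Suc n)) = restrict v {1..Suc n}"
      by (rule restrict_ext) (auto simp: w_def le_Suc_eq)
    then have vw: "v = ?ext w (v (Suc n))" using restrict_cube_id[OF v] by simp
    have closed: "ordered_product ?G n a w \<in> X" using G.ordered_product_closed[of a n w] a by simp
    have "ordered_product ?G (Suc n) a' v = ordered_product ?G n a' v \<otimes>\<^bsub>?G\<^esub> a' (Suc n) [^]\<^bsub>?G\<^esub> v (Suc n)"
      using G.ordered_product_Suc a' by simp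
    also have "ordered_product ?G n a' v = ordered_product ?G n a w"
      by (rule ordered_product_cong) (auto simp: a'_def w_def)
    also have "a' (Suc n) = t" by (simp add: a'_def)
    also have "ordered_product ?G n a w \<otimes>\<^bsub>?G\<^esub> t [^]\<^bsub>?G\<^esub> v (Suc n) = c (?ext w (v (Suc n)))"
    proof (cases "v (Suc n) = 0")
      case True
      show ?thesis unfolding True low[OF w] using closed t by simp
    next
      case False
      then have *: "v (Suc n) = 1" using cube_val[OF v, of "Suc n"] by simp
      show ?thesis unfolding * high[OF w] using closed t by simp
    qed
    also have "\<dots> = c v" using vw by simp
    finally show "c v = (\<lambda>v\<in>cube (Suc n). ordered_product ?G (Suc n) a' v) v" using v by simp
  qed simp
  with a' show ?case
    unfolding D1_cubes_eq carrier_translation_group by blast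
qed

text \<open>Off the all-one vertex, a map of this form is a corner whose faces are cubes by
  induction. From dimension 2 on, its completion again has this form by \<open>C_subset_D1\<close>,
  and agreement on the corner forces equality.\<close>

lemma D1_subset_C: "d \<in> D1_cubes translation_group n \<Longrightarrow> d \<in> C n"
proof (induction n arbitrary: d)
  case 0
  then obtain a where "a 0 \<in> X" "d = (\<lambda>v\<in>cube 0. ordered_product translation_group 0 a v)"
    unfolding D1_cubes_eq by auto
  moreover from this have "d = (\<lambda>v\<in>cube 0. a 0)" by (simp add: G.ordered_product_0)
  ultimately show ?case using const_in_C0[of "a 0"] by (simp only:)
next
  case (Suc n)
  have dX: "d \<in> cube (Suc n) \<rightarrow>\<^sub>E X"
    using Suc.prems cube_structure.cubes_subset[OF G.cube_structure_D1] by auto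
  show ?case
  proof (cases "n = 0")
    \<comment> \<open>In dimension 1 the values off the all-one vertex do not determine the map, but
      ergodicity applies.\<close>
    case True
    then show ?thesis using dX ergodicity by simp
  next
    case False
    let ?f = "restrict d (punctured_cube (Suc n))"
    have "corner (Suc n) ?f"
      unfolding corner_def
    proof (intro conjI ballI)
      show "?f \<in> punctured_cube (Suc n) \<rightarrow>\<^sub>E X"
        using dX by (auto simp: punctured_cube_def)
      fix i assume i: "i \<in> {1..Suc n}"
      have "compose (cube n) ?f (face (Suc n) i 0) = compose (cube n) d (face (Suc n) i 0)"
        unfolding compose_def using face_in_punctured_cube[OF i] by (intro restrict_ext) simp
      then show "compose (cube (Suc n - 1)) ?f (face (Suc n) i 0) \<in> C (Suc n - 1)"
        using Suc.IH[OF G.D1_cubes_face[OF Suc.prems i]] by simp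
    qed
    then obtain \<phi> where \<phi>: "\<phi> \<in> C (Suc n)" "restrict \<phi> (punctured_cube (Suc n)) = ?f"
      using completion unfolding completes_def by blast
    then have "\<phi> = d"
      using G.D1_cubes_eqI[OF C_subset_D1[OF \<phi>(1)] Suc.prems] False by simp
    with \<phi> show ?thesis by simp
  qed
qed

text \<open>The group has \<open>X\<close> itself as carrier, so the two inclusions of cubes make
  the identity an isomorphism.\<close>

lemma isomorphic_D1:
  "cube_structures_isomorphic X C (carrier translation_group) (D1_cubes translation_group)"
  unfolding cube_structures_isomorphic_def
proof (intro exI[of _ "\<lambda>x. x"] conjI allI ballI)
  show "bij_betw (\<lambda>x. x) X (carrier translation_group)" by (simp add: bij_betw_def)
  fix n c assume "c \<in> cube n \<rightarrow>\<^sub>E X"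
  then have "compose (cube n) (\<lambda>x. x) c = c"
    by (simp add: compose_def PiE_restrict)
  then show "c \<in> C n \<longleftrightarrow> compose (cube n) (\<lambda>x. x) c \<in> D1_cubes translation_group n"
    using C_subset_D1 D1_subset_C by auto
qed

end

theorem theorem8p5:
  fixes X :: "'a set" and C :: "nat \<Rightarrow> ((nat \<Rightarrow> nat) \<Rightarrow> 'a) set"
  assumes "step_groupspace 1 X C"
  shows "\<exists>G :: 'a monoid. group G \<and>
           cube_structures_isomorphic X C (carrier G) (D1_cubes G)"
proof -
  interpret step_groupspace 1 X C by fact
  \<comment> \<open>Any point of \<open>X\<close> serves as base point and becomes the identity of
    the group.\<close>
  obtain e where "e \<in> X" using nonempty by blast
  then interpret pointed_one_step_groupspace X C e by unfold_locales
  show ?thesis using translation_group_group isomorphic_D1 by blast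
qed

end
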